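(* Let $E^{\mathrm{ce}}$ be an equivalence relation on $\omega$ extending $=^{\mathrm{ce}}$ and let $\mathfrak{K}$ be a family of nonempty c.e. sets. If a learner $\mathbf{M}$ $E^{\mathrm{ce}}$-learns $\mathfrak{K}$, then for every $e\in\omega$ with $W_e\in\mathfrak{K}$ there is an $E^{\mathrm{ce}}$-locking sequence for $\mathbf{M}$ on $W_e$.
   Context: Fix a standard (acceptable) enumeration $(\varphi_e)_{e\in\omega}$ of the partial computable functions and let $W_e=\operatorname{dom}(\varphi_e)$. Write $e=^{\mathrm{ce}}e'$ iff $W_e=W_{e'}$. Equivalence relations on $\omega$ extending $=^{\mathrm{ce}}$ are arbitrary (no definability or effectivity is assumed). An enumeration of a set $A$ is a surjection $\mu:\omega\to A$; $\mu[s]$ denotes the finite string $\mu(0),\dots,\mu(s-1)$. A learner is an arbitrary function $\mathbf{M}:\omega^{<\omega}\to\omega$ (no effectivity is assumed). The learner $\mathbf{M}$ $E^{\mathrm{ce}}$-learns a family $\mathfrak{K}$ of nonempty c.e. sets if for every $e$ with $W_e\in\mathfrak{K}$ and every enumeration $\mu$ of $W_e$ there is $i\in\omega$ with $i\mathrel{E^{\mathrm{ce}}}e$ and $\mathbf{M}(\mu[s])=i$ for all sufficiently large $s$. For $\sigma\in\omega^{<\omega}$, $\operatorname{range}(\sigma)=\{\sigma(n):n<|\sigma|\}$, and $\sigma\tau$ denotes the concatenation of $\sigma$ followed by $\tau$. A finite string $\sigma\in\omega^{<\omega}$ is an $E^{\mathrm{ce}}$-locking sequence for $\mathbf{M}$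 on $W_e$ if: (a) $\operatorname{range}(\sigma)\subseteq W_e$; (b) $\mathbf{M}(\sigma)\mathrel{E^{\mathrm{ce}}}e$; (c) for every $\tau\in\omega^{<\omega}$, if $\operatorname{range}(\tau)\subseteq W_e$ then $\mathbf{M}(\sigma\tau)=\mathbf{M}(\sigma)$. *)

theory Defs
  imports Main
begin

section \<open>Partial computable functions\<close>

text \<open>
  Programs for the partial recursive functions and their graphs. Arities are not tracked:
  a program computes a partial function of every arity, undefined on argument lists that no
  rule matches.
\<close>

datatype recf =
    Zero
  | Succ
  | Proj nat
  | Comp recf "recf list"
  | Prec recf recf
  | Mn recf

inductive computes :: "recf \<Rightarrow> nat list \<Rightarrow> nat \<Rightarrow> bool" where
  zero: "computes Zero xs 0"
| succ: "computes Succ [x] (Suc x)"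
| proj: "i < length xs \<Longrightarrow> computes (Proj i) xs (xs ! i)"
| comp: "list_all2 (\<lambda>g y. computes g xs y) gs ys \<Longrightarrow> computes f ys z
    \<Longrightarrow> computes (Comp f gs) xs z"
| prec_0: "computes f xs z \<Longrightarrow> computes (Prec f g) (0 # xs) z"
| prec_Suc: "computes (Prec f g) (n # xs) y \<Longrightarrow> computes g (n # y # xs) z
    \<Longrightarrow> computes (Prec f g) (Suc n # xs) z"
| mn: "computes f (n # xs) 0 \<Longrightarrow> (\<forall>m<n. \<exists>y>0. computes f (m # xs) y)
    \<Longrightarrow> computes (Mn f) xs n"
monos list_all2_mono

inductive_cases computes_elims:
  "computes Zero xs z" "computes Succ xs z" "computes (Proj i) xs z"
  "computes (Comp f gs) xs z" "computes (Prec f g) (0 # xs) z"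
  "computes (Prec f g) (Suc n # xs) z" "computes (Mn f) xs z"

lemma computes_deterministic: "computes p xs y \<Longrightarrow> computes p xs z \<Longrightarrow> y = z"
proof (induction arbitrary: z rule: computes.induct)
  case (zero xs)
  then show ?case by (rule computes_elims(1)) simp
next
  case (succ x)
  then show ?case by (rule computes_elims(2)) simp
next
  case (proj i xs)
  from proj.prems show ?case by (rule computes_elims(3)) simp
next
  case (comp xs gs ys f w)
  from comp.prems obtain ys' where ys': "list_all2 (\<lambda>g y. computes g xs y) gs ys'"
    and f: "computes f ys' z"
    by (rule computes_elims(4))
  have "ys = ys'"
    using comp.IH(1) ys' by (auto simp: list_all2_conv_all_nth intro!: nth_equalityI)
  with f comp.IH(2) show ?case by simp
next
  case (prec_0 f xs w g)
  from prec_0.prems have "computes f xs z" by (rule computes_elims(5))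
  then show ?case by (rule prec_0.IH)
next
  case (prec_Suc f g n xs y w)
  from prec_Suc.prems obtain y' where y': "computes (Prec f g) (n # xs) y'"
    and z: "computes g (n # y' # xs) z"
    by (rule computes_elims(6))
  from prec_Suc.IH(1)[OF y'] z have "computes g (n # y # xs) z" by simp
  then show ?case by (rule prec_Suc.IH(2))
next
  case (mn f n xs)
  from mn.prems have z: "computes f (z # xs) 0" "\<forall>m<z. \<exists>y>0. computes f (m # xs) y"
    by (auto elim!: computes_elims(7))
  show ?case
  proof (cases n z rule: linorder_cases)
    case less
    with z(2) obtain y where "y > 0" "computes f (n # xs) y" by blast
    with mn.IH(1) show ?thesis by fastforce
  next
    case greater
    with mn.IH(2) z(1) show ?thesis by fastforce
  qed
qed

definition partial_computable :: "(nat \<Rightarrow> nat option) \<Rightarrow> bool" where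
  "partial_computable f \<longleftrightarrow> (\<exists>p. \<forall>x y. f x = Some y \<longleftrightarrow> computes p [x] y)"

definition partial_computable2 :: "(nat \<Rightarrow> nat \<Rightarrow> nat option) \<Rightarrow> bool" where
  "partial_computable2 f \<longleftrightarrow> (\<exists>p. \<forall>i x y. f i x = Some y \<longleftrightarrow> computes p [i, x] y)"

definition total_computable :: "(nat \<Rightarrow> nat) \<Rightarrow> bool" where
  "total_computable f \<longleftrightarrow> partial_computable (\<lambda>x. Some (f x))"

text \<open>
  An acceptable enumeration (in the sense of Rogers) of the unary partial computable functions:
  its universal function is partial computable, and every uniformly partial computable sequence
  of functions translates computably into it.
\<close>

definition acceptable :: "(nat \<Rightarrow> nat \<Rightarrow> nat option) \<Rightarrow> bool" where
  "acceptable \<phi> \<longleftrightarrow>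
     range \<phi> = {f. partial_computable f} \<and>
     partial_computable2 \<phi> \<and>
     (\<forall>\<psi>. partial_computable2 \<psi> \<longrightarrow> (\<exists>f. total_computable f \<and> (\<forall>i. \<phi> (f i) = \<psi> i)))"

definition W :: "(nat \<Rightarrow> nat \<Rightarrow> nat option) \<Rightarrow> nat \<Rightarrow> nat set" where
  "W \<phi> e = dom (\<phi> e)"

definition ce_eq :: "(nat \<Rightarrow> nat \<Rightarrow> nat option) \<Rightarrow> (nat \<times> nat) set" where
  "ce_eq \<phi> = {(e, e'). W \<phi> e = W \<phi> e'}"

definition computably_enumerable :: "nat set \<Rightarrow> bool" where
  "computably_enumerable A \<longleftrightarrow> (\<exists>f. partial_computable f \<and> A = dom f)"


section \<open>Learning\<close>

definition enumeration_of :: "(nat \<Rightarrow> nat) \<Rightarrow> nat set \<Rightarrow> bool" where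
  "enumeration_of \<mu> A \<longleftrightarrow> range \<mu> = A"

definition initial_segment :: "(nat \<Rightarrow> nat) \<Rightarrow> nat \<Rightarrow> nat list" where
  "initial_segment \<mu> s = map \<mu> [0..<s]"

definition learns ::
  "(nat \<Rightarrow> nat \<Rightarrow> nat option) \<Rightarrow> (nat \<times> nat) set \<Rightarrow> (nat list \<Rightarrow> nat) \<Rightarrow> nat set set \<Rightarrow> bool" where
  "learns \<phi> E M K \<longleftrightarrow>
     (\<forall>e. W \<phi> e \<in> K \<longrightarrow>
       (\<forall>\<mu>. enumeration_of \<mu> (W \<phi> e) \<longrightarrow>
         (\<exists>i. (i, e) \<in> E \<and> (\<exists>s0. \<forall>s\<ge>s0. M (initial_segment \<mu> s) = i))))"

definition locking_sequence ::
  "(nat \<Rightarrow> nat \<Rightarrow> nat option) \<Rightarrow> (nat \<times> nat) set \<Rightarrow> (nat list \<Rightarrow> nat) \<Rightarrow> nat \<Rightarrow> nat list \<Rightarrow> bool" where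
  "locking_sequence \<phi> E M e \<sigma> \<longleftrightarrow>
     set \<sigma> \<subseteq> W \<phi> e \<and>
     (M \<sigma>, e) \<in> E \<and>
     (\<forall>\<tau>. set \<tau> \<subseteq> W \<phi> e \<longrightarrow> M (\<sigma> @ \<tau>) = M \<sigma>)"

end

theory Submission
  imports Defs "HOL-Library.Sublist"
begin

text \<open>
  If no string over a nonempty set were locking, every string over it on which the learner makes
  a correct guess could be extended within the set to a string on which the learner changes its
  mind. Alternating such extensions with the elements of the set yields in the limit an
  enumeration on which the learner cannot converge to a correct guess.
\<close>

lemma set_initial_segment: "set (initial_segment \<mu> s) = \<mu> ` {..<s}"
  by (auto simp: initial_segment_def)

text \<open>Lets the learner be evaluated on strings that lie between two members of a chain with a
  known limit.\<close>

lemma initial_segment_prefix: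
  assumes "prefix xs (initial_segment \<mu> s)"
  shows "initial_segment \<mu> (length xs) = xs"
proof -
  have "xs = take (length xs) (initial_segment \<mu> s)" and "length xs \<le> s"
    using assms prefix_length_le[OF assms]
    by (auto simp: prefix_def initial_segment_def append_eq_conv_conj)
  then show ?thesis
    by (simp add: initial_segment_def take_map)
qed

text \<open>Strict growth gives \<open>S (Suc k)\<close> an entry at position \<open>k\<close>, and
  later strings keep it, so these entries define the limit. The length bound puts \<open>S n\<close>
  past any point of convergence that is at most \<open>n\<close>.\<close>

lemma strict_prefix_chain_limit:
  assumes "\<And>n. strict_prefix (S n) (S (Suc n))"
  obtains \<mu> where "\<And>n. initial_segment \<mu> (length (S n)) = S n" and "\<And>n. n \<le> length (S n)"
proof
  have prefix: "prefix (S m) (S n)" if "m \<le> n" for m n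
    using that
  proof (induction rule: dec_induct)
    case (step n)
    with assms[of n] show ?case
      by (auto simp: strict_prefix_def intro: prefix_order.trans)
  qed simp
  show long: "n \<le> length (S n)" for n
  proof (induction n)
    case (Suc n)
    with prefix_length_less[OF assms[of n]] show ?case by simp
  qed simp
  define \<mu> where "\<mu> k = S (Suc k) ! k" for k
  show "initial_segment \<mu> (length (S n)) = S n" for n
  proof (rule nth_equalityI)
    fix k assume "k < length (initial_segment \<mu> (length (S n)))"
    then have k: "k < length (S n)" "k < length (S (Suc k))"
      using long[of "Suc k"] by (auto simp: initial_segment_def)
    \<comment> \<open>Both strings reach position \<open>k\<close>, and one is a prefix of the
      other, in whichever order \<open>Suc k\<close> and \<open>n\<close> stand.\<close>
    have "S (Suc k) ! k = S n ! k"
      using prefix[of "Suc k" n] prefix[of n "Suc k"] k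
      by (cases "Suc k \<le> n") (auto simp: prefix_def nth_append)
    then show "initial_segment \<mu> (length (S n)) ! k = S n ! k"
      using k by (simp add: initial_segment_def \<mu>_def)
  qed (simp add: initial_segment_def)
qed

text \<open>\<open>G\<close> abstracts the set of correct guesses; in the application it is the
  \<open>E\<close>-class of \<open>e\<close>.\<close>

lemma ex_locking_string:
  fixes M :: "nat list \<Rightarrow> 'b" and A :: "nat set"
  assumes "A \<noteq> {}"
    and conv: "\<And>\<mu>. enumeration_of \<mu> A \<Longrightarrow>
      \<exists>i\<in>G. \<exists>s0. \<forall>s\<ge>s0. M (initial_segment \<mu> s) = i"
  shows "\<exists>\<sigma>. set \<sigma> \<subseteq> A \<and> M \<sigma> \<in> G \<and> (\<forall>\<tau>. set \<tau> \<subseteq> A \<longrightarrow> M (\<sigma> @ \<tau>) = M \<sigma>)"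
proof (rule ccontr)
  assume no_lock: "\<not> ?thesis"
  from \<open>A \<noteq> {}\<close> obtain a where "a \<in> A" by blast
  \<comment> \<open>The default value \<open>a\<close> makes \<open>f\<close> a total enumeration of
    \<open>A\<close>; nonemptiness enters here.\<close>
  define f where "f n = (if n \<in> A then n else a)" for n
  have f: "range f = A"
    using \<open>a \<in> A\<close> by (auto simp: f_def image_iff)
  \<comment> \<open>If \<open>M \<sigma>\<close> lies outside \<open>G\<close>, the empty string
    serves as \<open>\<tau>\<close>, so \<open>t\<close> is available at every stage.\<close>
  have "\<exists>\<tau>. set \<tau> \<subseteq> A \<and> (M \<sigma> \<in> G \<longrightarrow> M (\<sigma> @ \<tau>) \<noteq> M \<sigma>)" if "set \<sigma> \<subseteq> A" for \<sigma>
    using no_lock that by (metis set_empty empty_subsetI)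
  then obtain t where t: "\<And>\<sigma>. set \<sigma> \<subseteq> A \<Longrightarrow> set (t \<sigma>) \<subseteq> A"
    and t_change: "\<And>\<sigma>. set \<sigma> \<subseteq> A \<Longrightarrow> M \<sigma> \<in> G \<Longrightarrow> M (\<sigma> @ t \<sigma>) \<noteq> M \<sigma>"
    by metis
  \<comment> \<open>Appending \<open>f n\<close> makes the limit exhaust \<open>A\<close> and keeps
    the extension strict even when \<open>t \<sigma>\<close> is empty.\<close>
  define S where "S = rec_nat [] (\<lambda>n \<sigma>. \<sigma> @ t \<sigma> @ [f n])"
  have S_Suc: "S (Suc n) = S n @ t (S n) @ [f n]" for n
    by (simp add: S_def)
  have S_A: "set (S n) \<subseteq> A" for n
  proof (induction n)
    case (Suc n)
    with t[of "S n"] f show ?case by (auto simp: S_Suc)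
  qed (simp add: S_def)
  have "strict_prefix (S n) (S (Suc n))" for n
    by (simp add: S_Suc strict_prefix_def)
  then obtain \<mu> where \<mu>: "\<And>n. initial_segment \<mu> (length (S n)) = S n"
    and long: "\<And>n. n \<le> length (S n)"
    by (rule strict_prefix_chain_limit) blast
  have "range \<mu> = A"
  proof
    show "range \<mu> \<subseteq> A"
    proof clarify
      fix k
      have "\<mu> k \<in> set (initial_segment \<mu> (length (S (Suc k))))"
        using long[of "Suc k"] by (auto simp: set_initial_segment)
      with \<mu> S_A[of "Suc k"] show "\<mu> k \<in> A" by auto
    qed
    have "f n \<in> range \<mu>" for n
      using set_initial_segment[of \<mu> "length (S (Suc n))"] unfolding \<mu> by (auto simp: S_Suc)
    with f show "A \<subseteq> range \<mu>" by blast
  qed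
  then obtain i s where "i \<in> G" and i: "\<And>k. k \<ge> s \<Longrightarrow> M (initial_segment \<mu> k) = i"
    using conv[of \<mu>] unfolding enumeration_of_def by blast
  \<comment> \<open>The convergence point \<open>s\<close> doubles as a stage index, since
    \<open>S s\<close> has length at least \<open>s\<close>.\<close>
  have "M (S s) = i"
    using i[OF long] by (simp add: \<mu>)
  moreover have "M (S s @ t (S s)) = i"
  proof -
    \<comment> \<open>This string is \<open>S (Suc s)\<close> without its last entry, hence an
      initial segment of \<open>\<mu>\<close> of length at least \<open>s\<close>.\<close>
    have "prefix (S s @ t (S s)) (initial_segment \<mu> (length (S (Suc s))))"
      unfolding \<mu> by (simp add: S_Suc)
    from initial_segment_prefix[OF this] show ?thesis
      using i[of "length (S s @ t (S s))"] long[of s] by simp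
  qed
  ultimately show False
    using t_change[OF S_A, of s] \<open>i \<in> G\<close> by simp
qed

theorem theorem3p2:
  fixes \<phi> :: "nat \<Rightarrow> nat \<Rightarrow> nat option"
    and E :: "(nat \<times> nat) set"
    and K :: "nat set set"
    and M :: "nat list \<Rightarrow> nat"
  assumes "acceptable \<phi>"
    and "equiv UNIV E" and "ce_eq \<phi> \<subseteq> E"
    and "\<forall>A\<in>K. A \<noteq> {} \<and> computably_enumerable A"
    and "learns \<phi> E M K"
  shows "\<forall>e. W \<phi> e \<in> K \<longrightarrow> (\<exists>\<sigma>. locking_sequence \<phi> E M e \<sigma>)"
proof (intro allI impI)
  fix e assume e: "W \<phi> e \<in> K"
  have "\<exists>i\<in>{i. (i, e) \<in> E}. \<exists>s0. \<forall>s\<ge>s0. M (initial_segment \<mu> s) = i"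
    if "enumeration_of \<mu> (W \<phi> e)" for \<mu>
    using assms(5) e that unfolding learns_def by blast
  then show "\<exists>\<sigma>. locking_sequence \<phi> E M e \<sigma>"
    using ex_locking_string[of "W \<phi> e" "{i. (i, e) \<in> E}" M] assms(4) e
    unfolding locking_sequence_def by blast
qed

end
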